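(* Let $n\ge 1$ and let $T:\mathbb{H}^n\rightrightarrows V_1$ be a maximal H-monotone map such that $\mathrm{dom}(T)=\mathbb{H}^n$. Then $T$ is locally bounded.
   Context: The Heisenberg group $\mathbb{H}^n$ is $\mathbb{R}^n\times\mathbb{R}^n\times\mathbb{R}$ with group law $(x,y,t)\circ(x',y',t')=(x+x',y+y',t+t'+2(\langle x',y\rangle-\langle x,y'\rangle))$, with its usual (Euclidean) topology. $V_1\cong\mathbb{R}^{2n}$ is the first (horizontal) layer of its Lie algebra, with the Euclidean inner product $\langle\cdot,\cdot\rangle$ and norm, and $\xi_1:\mathbb{H}^n\to V_1$ is $\xi_1(x,y,t)=(x,y)$. For $\eta_0=(x_0,y_0,t_0)\in\mathbb{H}^n$ the horizontal plane through $\eta_0$ is $H_{\eta_0}=\{(x,y,t)\in\mathbb{H}^n: t=t_0+2(\langle y_0,x\rangle-\langle x_0,y\rangle)\}$. A set-valued map $T:\mathbb{H}^n\rightrightarrows V_1$ assigns to each $\eta$ a (possibly empty) subset $T(\eta)\subseteq V_1$; $\mathrm{dom}(T)=\{\eta: T(\eta)\ne\emptyset\}$ and $\mathrm{gr}(T)=\{(\eta,v): v\in T(\eta)\}$. A set $A\subset\mathbb{H}^n\times V_1$ is H-monotone if $\langle \xi_1(\eta)-\xi_1(\eta'),v-v'\rangle\ge 0$ for all $(\eta,v),(\eta',v')\in A$ with $\eta'\in H_\eta$; it is maximal H-monotone if it is H-monotone and is not properly contained in any H-monotone set. $T$ is (maximal) H-monotone if $\mathrm{gr}(T)$ is a (maximal)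 H-monotone set. $T$ is locally bounded if every point of $\mathbb{H}^n$ has a neighbourhood $U$ such that $T(U)=\bigcup_{\eta\in U}T(\eta)$ is a bounded subset of $V_1$. *)

theory Defs
  imports "HOL-Analysis.Analysis"
begin

text \<open>
  The index type \<open>'n\<close> of class \<open>finite\<close> plays the role of \<open>{1..n}\<close>, so \<open>n = CARD('n)\<close>; types are
  nonempty, hence \<open>n \<ge> 1\<close>.  A point of the Heisenberg group is a triple \<open>(x, y, t)\<close>.  The library's
  topology on products is the Euclidean one, and its inner product and norm on
  \<open>real ^ 'n \<times> real ^ 'n\<close> are the Euclidean ones of the \<open>2 n\<close>-dimensional space.
\<close>

type_synonym 'n heisenberg = "(real ^ 'n) \<times> (real ^ 'n) \<times> real"
type_synonym 'n V1 = "(real ^ 'n) \<times> (real ^ 'n)"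

fun heis_mult :: "'n::finite heisenberg \<Rightarrow> 'n heisenberg \<Rightarrow> 'n heisenberg" where
  "heis_mult (x, y, t) (x', y', t') =
     (x + x', y + y', t + t' + 2 * (x' \<bullet> y - x \<bullet> y'))"

fun xi1 :: "'n::finite heisenberg \<Rightarrow> 'n V1" where
  "xi1 (x, y, t) = (x, y)"

fun horizontal_plane :: "'n::finite heisenberg \<Rightarrow> 'n heisenberg set" where
  "horizontal_plane (x0, y0, t0) = {(x, y, t). t = t0 + 2 * (y0 \<bullet> x - x0 \<bullet> y)}"

text \<open>
  Compatibility of the two formulas: the horizontal plane through a point is the left translate by
  that point of the plane \<open>t = 0\<close>.
\<close>

lemma horizontal_plane_eq_left_translate:
  "horizontal_plane \<eta> = range (\<lambda>(a, b). heis_mult \<eta> (a, b, 0))"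
proof -
  obtain x0 y0 t0 where \<eta>: "\<eta> = (x0, y0, t0)"
    by (cases \<eta>) auto
  show ?thesis
  proof (intro set_eqI iffI)
    fix p assume "p \<in> horizontal_plane \<eta>"
    then obtain x y where "p = (x, y, t0 + 2 * (y0 \<bullet> x - x0 \<bullet> y))"
      by (auto simp: \<eta>)
    then have "p = (\<lambda>(a, b). heis_mult \<eta> (a, b, 0)) (x - x0, y - y0)"
      by (simp add: \<eta> inner_diff_left inner_diff_right inner_commute)
    then show "p \<in> range (\<lambda>(a, b). heis_mult \<eta> (a, b, 0))"
      by blast
  next
    fix p assume "p \<in> range (\<lambda>(a, b). heis_mult \<eta> (a, b, 0))"
    then show "p \<in> horizontal_plane \<eta>"
      by (auto simp: \<eta> inner_add_left inner_add_right inner_commute)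
  qed
qed

definition set_dom :: "('a \<Rightarrow> 'b set) \<Rightarrow> 'a set" where
  "set_dom T = {\<eta>. T \<eta> \<noteq> {}}"

definition set_graph :: "('a \<Rightarrow> 'b set) \<Rightarrow> ('a \<times> 'b) set" where
  "set_graph T = {(\<eta>, v). v \<in> T \<eta>}"

definition H_monotone_set :: "('n::finite heisenberg \<times> 'n V1) set \<Rightarrow> bool" where
  "H_monotone_set A \<longleftrightarrow>
     (\<forall>(\<eta>, v) \<in> A. \<forall>(\<eta>', v') \<in> A. \<eta>' \<in> horizontal_plane \<eta> \<longrightarrow>
        (xi1 \<eta> - xi1 \<eta>') \<bullet> (v - v') \<ge> 0)"

definition maximal_H_monotone_set :: "('n::finite heisenberg \<times> 'n V1) set \<Rightarrow> bool" where
  "maximal_H_monotone_set A \<longleftrightarrow> H_monotone_set A \<and> \<not> (\<exists>B. H_monotone_set B \<and> A \<subset> B)"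

definition maximal_H_monotone :: "('n::finite heisenberg \<Rightarrow> 'n V1 set) \<Rightarrow> bool" where
  "maximal_H_monotone T \<longleftrightarrow> maximal_H_monotone_set (set_graph T)"

definition locally_bounded_map :: "('n::finite heisenberg \<Rightarrow> 'n V1 set) \<Rightarrow> bool" where
  "locally_bounded_map T \<longleftrightarrow> (\<forall>\<eta>. \<exists>U. open U \<and> \<eta> \<in> U \<and> bounded (\<Union>\<eta>'\<in>U. T \<eta>'))"

end

theory Submission
  imports Defs
begin

text \<open>
  Suppose \<open>q\<close> lies on the horizontal planes of \<open>\<eta>\<close>, \<open>p\<close> and \<open>p'\<close>, and \<open>\<xi>\<^sub>1 q\<close> lies inside the triangle
  with vertices \<open>\<xi>\<^sub>1 \<eta>\<close>, \<open>\<xi>\<^sub>1 p\<close>, \<open>\<xi>\<^sub>1 p'\<close>.  Then \<open>\<xi>\<^sub>1 q - \<xi>\<^sub>1 \<eta> = \<alpha> (\<xi>\<^sub>1 p - \<xi>\<^sub>1 q) + \<beta> (\<xi>\<^sub>1 p' - \<xi>\<^sub>1 q)\<close>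
  with \<open>\<alpha>, \<beta> \<ge> 0\<close>, and H-monotonicity along the three horizontal segments from \<open>q\<close> eliminates the
  unknown value at \<open>q\<close>: for \<open>v \<in> T \<eta>\<close>, \<open>w \<in> T p\<close>, \<open>w' \<in> T p'\<close>,
  \<open>\<langle>\<xi>\<^sub>1 q - \<xi>\<^sub>1 \<eta>, v\<rangle> \<le> \<alpha> \<langle>\<xi>\<^sub>1 p - \<xi>\<^sub>1 q, w\<rangle> + \<beta> \<langle>\<xi>\<^sub>1 p' - \<xi>\<^sub>1 q, w'\<rangle>\<close>.
  For fixed \<open>p, p'\<close> the point \<open>q\<close> solves a linear system that depends continuously on \<open>\<eta>\<close>, and
  \<open>p, p'\<close> can be chosen so that \<open>\<xi>\<^sub>1 q - \<xi>\<^sub>1 \<eta>\<close> is any prescribed nonzero vector at a given base point.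
  Hence every component of \<open>T\<close> is bounded near that point.
\<close>

text \<open>The standard symplectic form on \<open>V1\<close>; twice this form is the twist term of
  the group law.\<close>

definition sympl :: "'n::finite V1 \<Rightarrow> 'n V1 \<Rightarrow> real" where
  "sympl z z' = snd z \<bullet> fst z' - fst z \<bullet> snd z'"

lemma bilinear_sympl: "bilinear sympl"
  unfolding bilinear_def linear_iff sympl_def
  by (auto simp: inner_add_left inner_add_right algebra_simps)

lemmas sympl_simps =
  bilinear_ladd[OF bilinear_sympl] bilinear_radd[OF bilinear_sympl]
  bilinear_lsub[OF bilinear_sympl] bilinear_rsub[OF bilinear_sympl]
  bilinear_lmul[OF bilinear_sympl] bilinear_rmul[OF bilinear_sympl]

lemma sympl_commute: "sympl z' z = - sympl z z'"
  by (simp add: sympl_def inner_commute)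

lemma sympl_self [simp]: "sympl z z = 0"
  by (simp add: sympl_def inner_commute)

lemma continuous_sympl [continuous_intros]:
  assumes "continuous F f" "continuous F g"
  shows "continuous F (\<lambda>x. sympl (f x) (g x))"
  unfolding sympl_def using assms by (intro continuous_intros)

lemma xi1_eq: "xi1 \<eta> = (fst \<eta>, fst (snd \<eta>))"
  by (cases \<eta>) auto

lemma continuous_xi1 [continuous_intros]: "continuous F f \<Longrightarrow> continuous F (\<lambda>x. xi1 (f x))"
  unfolding xi1_eq by (intro continuous_intros)

text \<open>The last coordinate of the group element \<open>\<eta>\<^sup>-\<^sup>1 \<circ> p\<close>.\<close>

definition vert :: "'n::finite heisenberg \<Rightarrow> 'n heisenberg \<Rightarrow> real" where
  "vert \<eta> p = snd (snd p) - snd (snd \<eta>) - 2 * sympl (xi1 \<eta>) (xi1 p)"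

lemma horizontal_plane_iff: "p \<in> horizontal_plane \<eta> \<longleftrightarrow> vert \<eta> p = 0"
  by (cases \<eta>; cases p) (auto simp: vert_def sympl_def)

lemma H_monotoneD:
  assumes "H_monotone_set (set_graph T)" "vert \<eta> \<eta>' = 0" "v \<in> T \<eta>" "v' \<in> T \<eta>'"
  shows "(xi1 \<eta>' - xi1 \<eta>) \<bullet> v \<le> (xi1 \<eta>' - xi1 \<eta>) \<bullet> v'"
proof -
  have "(xi1 \<eta> - xi1 \<eta>') \<bullet> (v - v') \<ge> 0"
    using assms unfolding H_monotone_set_def set_graph_def case_prod_unfold horizontal_plane_iff
    by (metis (mono_tags, lifting) fst_conv mem_Collect_eq snd_conv)
  then show ?thesis
    by (simp add: inner_diff_left inner_diff_right)
qed

text \<open>By Cramer's rule, \<open>l\<close> and \<open>m\<close> are the weights that put the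
  point \<open>q\<close> over \<open>xi1 \<eta> + c\<close>, at the height given by the plane of
  \<open>\<eta>\<close>, on the planes of \<open>p\<close> and \<open>p'\<close> too.\<close>

lemma three_point_bound:
  fixes T :: "'n::finite heisenberg \<Rightarrow> 'n V1 set"
  assumes mono: "H_monotone_set (set_graph T)" and dom: "set_dom T = UNIV"
    and a: "a = xi1 p - xi1 \<eta>" and b: "b = xi1 p' - xi1 \<eta>" and ab: "sympl a b \<noteq> 0"
    and l: "l = vert \<eta> p' / (2 * sympl a b)" and m: "m = - vert \<eta> p / (2 * sympl a b)"
    and pos: "l \<ge> 0" "m \<ge> 0" "l + m < 1"
    and c: "c = l *\<^sub>R a + m *\<^sub>R b"
    and v: "v \<in> T \<eta>" "vp \<in> T p" "vp' \<in> T p'"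
  shows "c \<bullet> v \<le> (l * ((a - c) \<bullet> vp) + m * ((b - c) \<bullet> vp')) / (1 - l - m)"
proof -
  define z where "z = xi1 \<eta> + c"
  define q :: "'n heisenberg" where "q = (fst z, snd z, snd (snd \<eta>) + 2 * sympl (xi1 \<eta>) c)"
  have xi_q: "xi1 q = xi1 \<eta> + c"
    by (simp add: q_def z_def prod_eq_iff)
  have xi_p: "xi1 p = xi1 \<eta> + a" "xi1 p' = xi1 \<eta> + b"
    by (simp_all add: a b)
  have "vert \<eta> q = 0"
    unfolding vert_def xi_q by (simp add: sympl_simps) (simp add: q_def)
  have vq: "vert q r = vert \<eta> r - 2 * sympl c d" if "xi1 r = xi1 \<eta> + d" for r d
    unfolding vert_def xi_q that using sympl_commute[of c "xi1 \<eta>"]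
    by (simp add: sympl_simps) (simp add: q_def)
  have "vert q p = 0"
    using vq[OF xi_p(1)] ab sympl_commute[of b a] by (simp add: c m sympl_simps)
  have "vert q p' = 0"
    using vq[OF xi_p(2)] ab by (simp add: c l sympl_simps)
  obtain vq where vq: "vq \<in> T q"
    using dom unfolding set_dom_def by blast
  have 1: "c \<bullet> v \<le> c \<bullet> vq"
    using H_monotoneD[OF mono \<open>vert \<eta> q = 0\<close> v(1) vq] by (simp add: xi_q)
  have 2: "(a - c) \<bullet> vq \<le> (a - c) \<bullet> vp"
    using H_monotoneD[OF mono \<open>vert q p = 0\<close> vq v(2)] by (simp add: xi_q xi_p)
  have 3: "(b - c) \<bullet> vq \<le> (b - c) \<bullet> vp'"
    using H_monotoneD[OF mono \<open>vert q p' = 0\<close> vq v(3)] by (simp add: xi_q xi_p)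
  \<comment> \<open>As \<open>c = l a + m b\<close>,
    \<open>(1 - l - m) c = l (a - c) + m (b - c)\<close>; this removes the unknown
    \<open>vq\<close>.\<close>
  have "(1 - l - m) * (c \<bullet> vq) = l * ((a - c) \<bullet> vq) + m * ((b - c) \<bullet> vq)"
    by (simp add: c inner_diff_left inner_add_left algebra_simps)
  also have "\<dots> \<le> l * ((a - c) \<bullet> vp) + m * ((b - c) \<bullet> vp')"
    by (intro add_mono mult_left_mono 2 3 pos)
  finally have "c \<bullet> vq \<le> (l * ((a - c) \<bullet> vp) + m * ((b - c) \<bullet> vp')) / (1 - l - m)"
    using pos by (simp add: field_simps)
  with 1 show ?thesis
    by linarith
qed

text \<open>The direction \<open>c\<close> of the three-point bound is \<open>u\<close> only at
  \<open>\<eta>0\<close>. Nearby it is within \<open>\<delta>\<close> of \<open>u\<close>, which by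
  Cauchy-Schwarz costs \<open>\<delta> * norm v\<close>.\<close>

lemma directional_bound:
  fixes T :: "'n::finite heisenberg \<Rightarrow> 'n V1 set"
  assumes mono: "H_monotone_set (set_graph T)" and dom: "set_dom T = UNIV"
    and "u \<noteq> 0" "\<delta> > 0"
  obtains C where "\<forall>\<^sub>F \<eta> in nhds \<eta>0. \<forall>v\<in>T \<eta>. u \<bullet> v \<le> C + \<delta> * norm v"
proof -
  \<comment> \<open>The rotation of \<open>u\<close> by the complex structure, so
    \<open>sympl u w\<close> is the squared norm of \<open>u\<close>. Hence \<open>2 u + w\<close>
    and \<open>2 u - w\<close> pair to \<open>-4 s\<close>, which is nonzero, and a quarter of their
    sum is \<open>u\<close>.\<close>
  define w where "w = (snd u, - fst u)"
  define s where "s = sympl u w"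
  have "s = u \<bullet> u"
    by (simp add: s_def w_def sympl_def inner_prod_def)
  with \<open>u \<noteq> 0\<close> have "s \<noteq> 0"
    by simp
  define zp where "zp = xi1 \<eta>0 + (2 *\<^sub>R u + w)"
  define zp' where "zp' = xi1 \<eta>0 + (2 *\<^sub>R u - w)"
  \<comment> \<open>The heights make \<open>l \<eta>0 = m \<eta>0 = 1/4\<close> below, so that \<open>c \<eta>0 = u\<close>.\<close>
  define p :: "'n heisenberg" where
    "p = (fst zp, snd zp, snd (snd \<eta>0) + 2 * sympl (xi1 \<eta>0) zp + 2 * s)"
  define p' :: "'n heisenberg" where
    "p' = (fst zp', snd zp', snd (snd \<eta>0) + 2 * sympl (xi1 \<eta>0) zp' - 2 * s)"
  obtain vp vp' where vp: "vp \<in> T p" "vp' \<in> T p'"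
    using dom by (fastforce simp: set_dom_def)
  define a where "a \<eta> = xi1 p - xi1 \<eta>" for \<eta>
  define b where "b \<eta> = xi1 p' - xi1 \<eta>" for \<eta>
  define \<Omega> where "\<Omega> \<eta> = sympl (a \<eta>) (b \<eta>)" for \<eta>
  define l where "l \<eta> = vert \<eta> p' / (2 * \<Omega> \<eta>)" for \<eta>
  define m where "m \<eta> = - vert \<eta> p / (2 * \<Omega> \<eta>)" for \<eta>
  define c where "c \<eta> = l \<eta> *\<^sub>R a \<eta> + m \<eta> *\<^sub>R b \<eta>" for \<eta>
  define R where "R \<eta> = (l \<eta> * ((a \<eta> - c \<eta>) \<bullet> vp) + m \<eta> * ((b \<eta> - c \<eta>) \<bullet> vp')) / (1 - l \<eta> - m \<eta>)" for \<eta>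
  have xi_p: "xi1 p = zp" "xi1 p' = zp'"
    by (simp_all add: p_def p'_def)
  have a0: "a \<eta>0 = 2 *\<^sub>R u + w" and b0: "b \<eta>0 = 2 *\<^sub>R u - w"
    by (simp_all add: a_def b_def xi_p zp_def zp'_def)
  have \<Omega>0: "\<Omega> \<eta>0 = - 4 * s"
    using sympl_commute[of w u] by (simp add: \<Omega>_def a0 b0 sympl_simps s_def)
  have "vert \<eta>0 p = 2 * s" "vert \<eta>0 p' = - 2 * s"
    unfolding vert_def xi_p by (simp_all add: p_def p'_def)
  then have l0: "l \<eta>0 = 1/4" and m0: "m \<eta>0 = 1/4"
    using \<open>s \<noteq> 0\<close> by (simp_all add: l_def m_def \<Omega>0)
  have c0: "c \<eta>0 = u"
    by (simp add: c_def l0 m0 a0 b0 scaleR_add_right scaleR_diff_right flip: scaleR_add_left)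
  have cont_ab: "isCont a \<eta>0" "isCont b \<eta>0"
    unfolding a_def b_def by (intro continuous_intros)+
  then have cont_\<Omega>: "isCont \<Omega> \<eta>0"
    unfolding \<Omega>_def by (intro continuous_intros)
  then have cont_lm: "isCont l \<eta>0" "isCont m \<eta>0"
    unfolding l_def m_def vert_def using \<Omega>0 \<open>s \<noteq> 0\<close> by (intro continuous_intros; simp)+
  with cont_ab have cont_c: "isCont c \<eta>0"
    unfolding c_def by (intro continuous_intros)
  have cont_R: "isCont R \<eta>0"
    unfolding R_def using l0 m0 by (intro continuous_intros cont_ab cont_lm cont_c) simp
  \<comment> \<open>Limits along \<open>nhds\<close>, not \<open>at\<close>, so that the
    neighbourhoods include \<open>\<eta>0\<close> itself.\<close>
  have tend: "(f \<longlongrightarrow> f \<eta>0) (nhds \<eta>0)" if "isCont f \<eta>0" for f :: "'n heisenberg \<Rightarrow> 'z::topological_space"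
    using that by (simp add: isCont_def tendsto_at_iff_tendsto_nhds)
  have "\<forall>\<^sub>F \<eta> in nhds \<eta>0. \<Omega> \<eta> \<noteq> 0"
    using tendsto_imp_eventually_ne[OF tend[OF cont_\<Omega>]] \<Omega>0 \<open>s \<noteq> 0\<close> by simp
  moreover have "\<forall>\<^sub>F \<eta> in nhds \<eta>0. l \<eta> > 0" "\<forall>\<^sub>F \<eta> in nhds \<eta>0. m \<eta> > 0"
    using order_tendstoD(1)[OF tend[OF cont_lm(1)]] order_tendstoD(1)[OF tend[OF cont_lm(2)]]
    by (simp_all add: l0 m0)
  \<comment> \<open>Each weight below \<open>1/2\<close> ensures \<open>l + m < 1\<close>.\<close>
  moreover have "\<forall>\<^sub>F \<eta> in nhds \<eta>0. l \<eta> < 1/2" "\<forall>\<^sub>F \<eta> in nhds \<eta>0. m \<eta> < 1/2"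
    using order_tendstoD(2)[OF tend[OF cont_lm(1)], of "1/2"]
      order_tendstoD(2)[OF tend[OF cont_lm(2)], of "1/2"]
    by (simp_all add: l0 m0)
  moreover have "\<forall>\<^sub>F \<eta> in nhds \<eta>0. R \<eta> < R \<eta>0 + 1"
    using order_tendstoD(2)[OF tend[OF cont_R]] by simp
  moreover have "\<forall>\<^sub>F \<eta> in nhds \<eta>0. dist (c \<eta>) u < \<delta>"
    using tendstoD[OF tend[OF cont_c] \<open>\<delta> > 0\<close>] by (simp add: c0)
  ultimately have "\<forall>\<^sub>F \<eta> in nhds \<eta>0. \<forall>v\<in>T \<eta>. u \<bullet> v \<le> (R \<eta>0 + 1) + \<delta> * norm v"
  proof eventually_elim
    case (elim \<eta>)
    show ?case
    proof
      fix v assume "v \<in> T \<eta>"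
      have "c \<eta> \<bullet> v \<le> R \<eta>"
        unfolding R_def
        by (rule three_point_bound[OF mono dom a_def b_def])
          (use elim \<open>v \<in> T \<eta>\<close> vp in \<open>auto simp: \<Omega>_def l_def m_def c_def\<close>)
      moreover have "(u - c \<eta>) \<bullet> v \<le> \<delta> * norm v"
        using norm_cauchy_schwarz[of "u - c \<eta>" v] elim
          mult_right_mono[of "norm (u - c \<eta>)" \<delta> "norm v"]
        by (simp add: dist_norm norm_minus_commute)
      ultimately show "u \<bullet> v \<le> (R \<eta>0 + 1) + \<delta> * norm v"
        using elim by (simp add: inner_diff_left)
    qed
  qed
  then show thesis
    by (rule that)
qed

theorem theorem1p1:
  fixes T :: "'n::finite heisenberg \<Rightarrow> 'n V1 set"
  assumes "maximal_H_monotone T"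
    and "set_dom T = UNIV"
  shows "locally_bounded_map T"
  unfolding locally_bounded_map_def
proof
  fix \<eta>0 :: "'n heisenberg"
  have mono: "H_monotone_set (set_graph T)"
    using assms(1) by (simp add: maximal_H_monotone_def maximal_H_monotone_set_def)
  define B :: "'n V1 set" where "B = Basis"
  define d where "d = real (card B)"
  have "d > 0"
    by (simp add: d_def B_def)
  \<comment> \<open>Summed over the \<open>d\<close> basis vectors, the errors
    \<open>\<delta> * norm v\<close> make \<open>norm v / 2\<close>, which the left side
    absorbs.\<close>
  define \<delta> where "\<delta> = 1 / (2 * d)"
  have "\<delta> > 0"
    using \<open>d > 0\<close> by (simp add: \<delta>_def)
  have "\<exists>C. \<forall>\<^sub>F \<eta> in nhds \<eta>0. \<forall>v\<in>T \<eta>. \<bar>v \<bullet> i\<bar> \<le> C + \<delta> * norm v" if "i \<in> B" for i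
  proof -
    have "i \<noteq> 0" "- i \<noteq> 0"
      using that by (auto simp: B_def)
    obtain C where "\<forall>\<^sub>F \<eta> in nhds \<eta>0. \<forall>v\<in>T \<eta>. i \<bullet> v \<le> C + \<delta> * norm v"
      using directional_bound[OF mono assms(2) \<open>i \<noteq> 0\<close> \<open>\<delta> > 0\<close>] .
    moreover obtain C' where "\<forall>\<^sub>F \<eta> in nhds \<eta>0. \<forall>v\<in>T \<eta>. - i \<bullet> v \<le> C' + \<delta> * norm v"
      using directional_bound[OF mono assms(2) \<open>- i \<noteq> 0\<close> \<open>\<delta> > 0\<close>] .
    ultimately have "\<forall>\<^sub>F \<eta> in nhds \<eta>0. \<forall>v\<in>T \<eta>. \<bar>v \<bullet> i\<bar> \<le> max C C' + \<delta> * norm v"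
      by eventually_elim (force simp: inner_commute abs_le_iff)
    then show ?thesis ..
  qed
  then have "\<exists>C. \<forall>i\<in>B. \<forall>\<^sub>F \<eta> in nhds \<eta>0. \<forall>v\<in>T \<eta>. \<bar>v \<bullet> i\<bar> \<le> C i + \<delta> * norm v"
    by (intro bchoice ballI)
  then obtain C where "\<forall>i\<in>B. \<forall>\<^sub>F \<eta> in nhds \<eta>0. \<forall>v\<in>T \<eta>. \<bar>v \<bullet> i\<bar> \<le> C i + \<delta> * norm v"
    by blast
  then have "\<forall>\<^sub>F \<eta> in nhds \<eta>0. \<forall>i\<in>B. \<forall>v\<in>T \<eta>. \<bar>v \<bullet> i\<bar> \<le> C i + \<delta> * norm v"
    by (intro eventually_ball_finite) (auto simp: B_def)
  then obtain U where U: "open U" "\<eta>0 \<in> U"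
    and bd: "\<And>\<eta> i v. \<eta> \<in> U \<Longrightarrow> i \<in> B \<Longrightarrow> v \<in> T \<eta> \<Longrightarrow> \<bar>v \<bullet> i\<bar> \<le> C i + \<delta> * norm v"
    unfolding eventually_nhds by blast
  have "norm v \<le> 2 * sum C B" if "\<eta> \<in> U" "v \<in> T \<eta>" for \<eta> v
  proof -
    have "norm v \<le> (\<Sum>i\<in>B. \<bar>v \<bullet> i\<bar>)"
      unfolding B_def by (rule norm_le_l1)
    also have "\<dots> \<le> (\<Sum>i\<in>B. C i + \<delta> * norm v)"
      by (intro sum_mono bd[OF that(1) _ that(2)])
    also have "\<dots> = sum C B + norm v / 2"
      using \<open>d > 0\<close> by (simp add: sum.distrib \<delta>_def flip: d_def)
    finally show ?thesis
      by simp
  qed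
  then have "bounded (\<Union>\<eta>\<in>U. T \<eta>)"
    unfolding bounded_iff by blast
  with U show "\<exists>U. open U \<and> \<eta>0 \<in> U \<and> bounded (\<Union>\<eta>'\<in>U. T \<eta>')"
    by blast
qed

end
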